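(* Let $\omega$ be a multiplicative function on permutations with values in a commutative $\mathbb{Q}$-algebra $R$. For $n\geq0$ let $\overline{\gamma_n}=\sum_{\pi\in S_n}\omega(\pi)q^{\overline{I}(\pi)}$, for $n\ge1$ let $\overline{f_n}=\sum_{\beta\in B_n}\omega(\beta)q^{\overline{I}(\beta)}$, and let $\overline{F}(t)=\sum_{n\geq1}\overline{f_n}\,t^n/[n]_q!$. Then, in $A[[t]]$ with $A=R\otimes_{\mathbb{Q}}\mathbb{Q}(q)$, \[ \sum_{n\geq0}\overline{\gamma_n}\frac{t^n}{[n]_q!}=\mathbf{E}_q\big[\overline{F}(t)\big]^*_q . \]
   Context: A permutation of a finite set $E\subset\mathbb{N}$ with $|E|=n$ is a word $a_1a_2\cdots a_n$ using each element of $E$ once; its content is $E$. It is basic if it begins with its greatest element. $S_n$ (resp. $B_n$) is the set of permutations (resp. basic permutations) of $\{1,\dots,n\}$ ($S_0$ contains only the empty permutation). The reduction $red(\pi)$ of $\pi=a_1\cdots a_n$ replaces the $i$-th smallest letter by $i$. The basic decomposition of $\pi$ is the set $\{\beta_1,\dots,\beta_k\}$ of factors obtained by cutting $\pi$ immediately before each left-to-right maximum (each letter larger than all letters to its left); each $\beta_j$ is basic. A function $\omega$ on permutations is multiplicative if $\omega(\pi)=\omega(red(\pi))$ for all $\pi$ and $\omega(\pi)=\omega(\beta_1)\cdots\omega(\beta_k)$ whenever $\{\beta_1,\dots,\beta_k\}$ is the basic decomposition of $\pi$. A non-inversion of $\pi=a_1\cdots a_n$ is a pair $(i,j)$ with $i<j$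 and $a_i<a_j$; $\overline I(\pi)$ is their number. $[n]_q=1+q+\cdots+q^{n-1}$, $[0]_q=0$, $[n]_q!=[1]_q\cdots[n]_q$, $[0]_q!=1$, $D_qF(t)=\frac{F(qt)-F(t)}{(q-1)t}$. $q^*$-composition: for $F\in A[[t]]$ with $F(0)=0$, $F^{[0]^*}=1$ and for $k\ge1$, $F^{[k]^*}$ is the unique series with zero constant term such that $D_qF^{[k]^*}(t)=[k]_q q^{-(k-1)}F^{[k-1]^*}(qt)D_qF(t)$; for $G(t)=\sum_k g_kt^k/[k]_q!$, $G[F]^*_q=\sum_k g_kF^{[k]^*}/[k]_q!$. $\mathbf{E}_q(t)=\sum_{n\ge0}q^{\binom n2}t^n/[n]_q!$. *)

theory Defs
  imports
    "HOL-Combinatorics.Multiset_Permutations"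
    "HOL-Computational_Algebra.Formal_Power_Series"
    "HOL-Computational_Algebra.Fraction_Field"
    "HOL-Computational_Algebra.Polynomial"
begin

section \<open>Permutations as words\<close>

text \<open>A permutation with content \<open>E\<close> is an element of \<^term>\<open>permutations_of_set E\<close>,
  i.e. a distinct word whose set of letters is \<open>E\<close>; positions are counted from 0.\<close>

definition basic :: "nat list \<Rightarrow> bool" where
  "basic w \<longleftrightarrow> distinct w \<and> w \<noteq> [] \<and> hd w = Max (set w)"

definition red :: "nat list \<Rightarrow> nat list" where
  "red w = map (\<lambda>x. card {y \<in> set w. y \<le> x}) w"

definition lr_max_positions :: "nat list \<Rightarrow> nat set" where
  "lr_max_positions w = {i. i < length w \<and> (\<forall>j<i. w ! j < w ! i)}"

text \<open>The factors run from one left-to-right maximum to just before the next one, or to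
  the end of the word.\<close>

definition basic_decomposition :: "nat list \<Rightarrow> nat list set" where
  "basic_decomposition w =
     {take (j - i) (drop i w) | i j.
        i \<in> lr_max_positions w \<and> j \<in> insert (length w) (lr_max_positions w) \<and> i < j \<and>
        (\<forall>k \<in> lr_max_positions w. \<not> (i < k \<and> k < j))}"

text \<open>Only the values on words with distinct letters matter.  The empty permutation has the
  empty decomposition, so that a multiplicative function takes the value 1 there.\<close>

definition multiplicative_fun :: "(nat list \<Rightarrow> 'r::comm_ring_1) \<Rightarrow> bool" where
  "multiplicative_fun \<omega> \<longleftrightarrow>
     (\<forall>w. distinct w \<longrightarrow> \<omega> w = \<omega> (red w) \<and> \<omega> w = (\<Prod>\<beta> \<in> basic_decomposition w. \<omega> \<beta>))"

definition noninversions :: "nat list \<Rightarrow> nat" where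
  "noninversions w = card {(i, j). i < j \<and> j < length w \<and> w ! i < w ! j}"

definition perms :: "nat \<Rightarrow> nat list set" where
  "perms n = permutations_of_set {1..n}"

definition basic_perms :: "nat \<Rightarrow> nat list set" where
  "basic_perms n = {w \<in> perms n. basic w}"


section \<open>Commutative \<open>\<rat>\<close>-algebras\<close>

class comm_rat_algebra = comm_ring_1 +
  fixes scaleQ :: "rat \<Rightarrow> 'a \<Rightarrow> 'a"
  assumes scaleQ_add_right: "scaleQ c (x + y) = scaleQ c x + scaleQ c y"
    and scaleQ_add_left: "scaleQ (c + d) x = scaleQ c x + scaleQ d x"
    and scaleQ_scaleQ: "scaleQ c (scaleQ d x) = scaleQ (c * d) x"
    and scaleQ_one: "scaleQ 1 x = x"
    and mult_scaleQ_left: "scaleQ c x * y = scaleQ c (x * y)"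

lemma mult_scaleQ_right: "x * scaleQ c y = scaleQ c (x * y)" for x :: "'a::comm_rat_algebra"
  by (metis mult.commute mult_scaleQ_left)

lemma vector_space_scaleQ: "vector_space (scaleQ :: rat \<Rightarrow> 'a::comm_rat_algebra \<Rightarrow> 'a)"
  by unfold_locales (simp_all add: scaleQ_add_right scaleQ_add_left scaleQ_scaleQ scaleQ_one)

instantiation rat :: comm_rat_algebra
begin
definition scaleQ_rat :: "rat \<Rightarrow> rat \<Rightarrow> rat" where "scaleQ_rat c x = c * x"
instance by standard (simp_all add: scaleQ_rat_def algebra_simps)
end

instantiation poly :: (comm_rat_algebra) comm_rat_algebra
begin
definition scaleQ_poly :: "rat \<Rightarrow> 'a poly \<Rightarrow> 'a poly" where
  "scaleQ_poly c p = smult (scaleQ c 1) p"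
instance
  by standard (simp_all add: scaleQ_poly_def smult_add_right smult_add_left[symmetric]
      scaleQ_add_left scaleQ_one mult_scaleQ_left scaleQ_scaleQ)
end

instantiation fract :: ("{idom, comm_rat_algebra}") comm_rat_algebra
begin
definition scaleQ_fract :: "rat \<Rightarrow> 'a fract \<Rightarrow> 'a fract" where
  "scaleQ_fract c x = Fract (scaleQ c 1) 1 * x"
instance
proof
  fix c d :: rat and x y :: "'a fract"
  show "scaleQ c (x + y) = scaleQ c x + scaleQ c y"
    by (simp add: scaleQ_fract_def algebra_simps)
  have "Fract (scaleQ (c + d) (1::'a)) 1 = Fract (scaleQ c 1) 1 + Fract (scaleQ d 1) 1"
    by (simp add: scaleQ_add_left)
  then show "scaleQ (c + d) x = scaleQ c x + scaleQ d x"
    unfolding scaleQ_fract_def by (simp only: distrib_right)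
  have "Fract (scaleQ c (1::'a)) 1 * Fract (scaleQ d 1) 1 = Fract (scaleQ (c * d) 1) 1"
    by (simp add: mult_scaleQ_left scaleQ_scaleQ)
  then show "scaleQ c (scaleQ d x) = scaleQ (c * d) x"
    unfolding scaleQ_fract_def by (simp only: mult.assoc[symmetric])
  show "scaleQ 1 x = x"
    by (simp add: scaleQ_fract_def scaleQ_one One_fract_def[symmetric])
  show "scaleQ c x * y = scaleQ c (x * y)"
    by (simp add: scaleQ_fract_def mult.assoc)
qed
end


section \<open>The tensor product of two commutative \<open>\<rat>\<close>-algebras\<close>

text \<open>A multiset of pairs stands for the formal sum of the tensors \<open>a \<otimes> b\<close>.  The multisets
  form only a commutative monoid, so that \<open>0 \<otimes> b = 0\<close> has to be imposed; the class of
  \<open>(- a, b)\<close> is then the negative of the class of \<open>(a, b)\<close>, and the quotient is the usual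
  abelian group \<open>R \<otimes>\<^sub>\<rat> S\<close>.\<close>

inductive tensor_eq ::
  "('a::comm_rat_algebra \<times> 'b::comm_rat_algebra) multiset \<Rightarrow> ('a \<times> 'b) multiset \<Rightarrow> bool" where
  refl: "tensor_eq X X"
| sym: "tensor_eq X Y \<Longrightarrow> tensor_eq Y X"
| trans: "tensor_eq X Y \<Longrightarrow> tensor_eq Y Z \<Longrightarrow> tensor_eq X Z"
| add: "tensor_eq X X' \<Longrightarrow> tensor_eq Y Y' \<Longrightarrow> tensor_eq (X + Y) (X' + Y')"
| add_left: "tensor_eq {#(a + a', b)#} {#(a, b), (a', b)#}"
| add_right: "tensor_eq {#(a, b + b')#} {#(a, b), (a, b')#}"
| scale: "tensor_eq {#(scaleQ c a, b)#} {#(a, scaleQ c b)#}"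
| zero: "tensor_eq {#(0, b)#} {#}"

quotient_type (overloaded) ('a, 'b) tensor =
  "('a::comm_rat_algebra \<times> 'b::comm_rat_algebra) multiset" / tensor_eq
  by (intro equivpI reflpI sympI transpI) (blast intro: tensor_eq.intros)+

lift_definition pure_tensor ::
  "'a::comm_rat_algebra \<Rightarrow> 'b::comm_rat_algebra \<Rightarrow> ('a, 'b) tensor"  (infixl "\<otimes>\<^sub>Q" 72)
  is "\<lambda>a b. {#(a, b)#}" .

definition tensor_times_raw ::
  "('a::comm_rat_algebra \<times> 'b::comm_rat_algebra) multiset \<Rightarrow> ('a \<times> 'b) multiset \<Rightarrow>
     ('a \<times> 'b) multiset" where
  "tensor_times_raw X Y = (\<Sum>x\<in>#X. {#(fst x * fst y, snd x * snd y). y \<in># Y#})"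

lemma tensor_times_raw_simps [simp]:
  "tensor_times_raw {#} Y = {#}"
  "tensor_times_raw X {#} = {#}"
  "tensor_times_raw (X + X') Y = tensor_times_raw X Y + tensor_times_raw X' Y"
  "tensor_times_raw X (Y + Y') = tensor_times_raw X Y + tensor_times_raw X Y'"
  "tensor_times_raw {#(a, b)#} {#(c, d)#} = {#(a * c, b * d)#}"
  by (simp_all add: tensor_times_raw_def sum_mset.distrib)

lemma tensor_times_raw_add_mset_left:
  "tensor_times_raw (add_mset x X) Y = tensor_times_raw {#x#} Y + tensor_times_raw X Y"
  by (simp add: tensor_times_raw_def)

lemma tensor_times_raw_add_mset_right:
  "tensor_times_raw X (add_mset y Y) = tensor_times_raw X {#y#} + tensor_times_raw X Y"
  by (metis add_mset_add_single tensor_times_raw_simps(4) union_commute)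

lemma tensor_times_raw_commute: "tensor_times_raw X Y = tensor_times_raw Y X"
proof (induction X)
  case (add x X)
  have "tensor_times_raw {#x#} Y = tensor_times_raw Y {#x#}"
  proof (induction Y)
    case (add y Y)
    then show ?case
      by (cases x; cases y) (simp add: tensor_times_raw_add_mset_right[of _ _ Y]
            tensor_times_raw_add_mset_left[of _ Y] mult.commute)
  qed simp
  with add show ?case
    by (simp add: tensor_times_raw_add_mset_right[of _ _ X] tensor_times_raw_add_mset_left[of _ X])
qed simp

lemma tensor_times_raw_assoc:
  "tensor_times_raw (tensor_times_raw X Y) Z = tensor_times_raw X (tensor_times_raw Y Z)"
proof (induction X)
  case (add x X)
  have "tensor_times_raw (tensor_times_raw {#x#} Y) Z = tensor_times_raw {#x#} (tensor_times_raw Y Z)"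
  proof (induction Y)
    case (add y Y)
    have "tensor_times_raw (tensor_times_raw {#x#} {#y#}) Z =
        tensor_times_raw {#x#} (tensor_times_raw {#y#} Z)"
    proof (induction Z)
      case (add z Z)
      then show ?case
        by (cases x; cases y; cases z)
          (simp add: tensor_times_raw_add_mset_right[of _ _ Z]
            tensor_times_raw_add_mset_right[of _ _ "tensor_times_raw W Z" for W] mult.assoc)
    qed simp
    with add show ?case
      by (simp add: tensor_times_raw_add_mset_right[of _ _ Y] tensor_times_raw_add_mset_left[of _ Y])
  qed simp
  with add show ?case by (simp add: tensor_times_raw_add_mset_left[of _ X])
qed simp

lemma tensor_times_raw_one: "tensor_times_raw {#(1, 1)#} X = X"
  by (simp add: tensor_times_raw_def)

lemma tensor_eq_times_single:
  assumes "tensor_eq X Y"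
  shows "tensor_eq (tensor_times_raw X {#z#}) (tensor_times_raw Y {#z#})"
  using assms
proof induction
  case (add_left a a' b)
  show ?case
    using tensor_eq.add_left[of "a * fst z" "a' * fst z" "b * snd z"]
    by (simp add: tensor_times_raw_def distrib_right add_mset_commute)
next
  case (add_right a b b')
  show ?case
    using tensor_eq.add_right[of "a * fst z" "b * snd z" "b' * snd z"]
    by (simp add: tensor_times_raw_def distrib_right add_mset_commute)
next
  case (scale c a b)
  then show ?case by (cases z) (simp add: tensor_times_raw_def mult_scaleQ_left tensor_eq.scale)
next
  case (zero b)
  then show ?case by (cases z) (simp add: tensor_times_raw_def tensor_eq.zero)
next
  case (trans X Y Z)
  then show ?case by (blast intro: tensor_eq.trans)
qed (simp_all add: tensor_eq.refl tensor_eq.sym tensor_eq.add)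

lemma tensor_eq_times_left:
  assumes "tensor_eq X Y"
  shows "tensor_eq (tensor_times_raw X Z) (tensor_times_raw Y Z)"
proof (induction Z)
  case (add z Z)
  then show ?case
    by (simp add: tensor_times_raw_add_mset_right[of _ _ Z]
        tensor_eq.add[OF tensor_eq_times_single[OF assms]])
qed (simp add: tensor_eq.refl)

lemma tensor_eq_times:
  assumes "tensor_eq X X'" "tensor_eq Y Y'"
  shows "tensor_eq (tensor_times_raw X Y) (tensor_times_raw X' Y')"
  by (metis assms tensor_eq.trans tensor_eq_times_left tensor_times_raw_commute)

definition tensor_uminus_raw ::
  "('a::comm_rat_algebra \<times> 'b::comm_rat_algebra) multiset \<Rightarrow> ('a \<times> 'b) multiset" where
  "tensor_uminus_raw = tensor_times_raw {#(- 1, 1)#}"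

lemma tensor_eq_uminus_add: "tensor_eq (tensor_uminus_raw X + X) {#}"
proof -
  have "tensor_eq {#(- 1, 1), (1, 1)#} {#(- 1 + 1, 1)#}"
    by (rule tensor_eq.sym, rule tensor_eq.add_left)
  then have "tensor_eq {#(- 1, 1), (1, 1)#} {#}"
    using tensor_eq.trans[OF _ tensor_eq.zero] by simp
  from tensor_eq_times_left[OF this, of X] show ?thesis
    by (simp add: tensor_uminus_raw_def tensor_times_raw_one
        tensor_times_raw_add_mset_left[of _ "{#(1, 1)#}"])
qed

text \<open>A pair of linear functionals induces a functional on the tensor product; it is used to see
  that \<open>1 \<otimes> 1 \<noteq> 0\<close>.\<close>

lemma ex_linear_functional_one:
  "\<exists>f :: 'a::comm_rat_algebra \<Rightarrow> rat.
     (\<forall>x y. f (x + y) = f x + f y) \<and> (\<forall>c x. f (scaleQ c x) = c * f x) \<and> f 1 = 1"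
proof -
  interpret V: vector_space "scaleQ :: rat \<Rightarrow> 'a \<Rightarrow> 'a" by (rule vector_space_scaleQ)
  interpret W: vector_space "(*) :: rat \<Rightarrow> rat \<Rightarrow> rat"
    by unfold_locales (simp_all add: algebra_simps)
  interpret P: vector_space_pair "scaleQ :: rat \<Rightarrow> 'a \<Rightarrow> 'a" "(*) :: rat \<Rightarrow> rat \<Rightarrow> rat" ..
  have "V.independent {1}" by simp
  from P.linear_independent_extend[OF this, of "\<lambda>_. 1"] obtain g
    where g: "Vector_Spaces.linear (scaleQ :: rat \<Rightarrow> 'a \<Rightarrow> 'a) (*) g" "g 1 = 1" by auto
  interpret g: Vector_Spaces.linear "scaleQ :: rat \<Rightarrow> 'a \<Rightarrow> 'a" "(*)" g by fact
  show ?thesis using g.add g.scale g(2) by blast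
qed

lemma not_tensor_eq_one_zero:
  "\<not> tensor_eq {#(1 :: 'a::comm_rat_algebra, 1 :: 'b::comm_rat_algebra)#} {#}"
proof
  obtain f :: "'a \<Rightarrow> rat" where f: "\<And>x y. f (x + y) = f x + f y" "\<And>c x. f (scaleQ c x) = c * f x"
    "f 1 = 1" using ex_linear_functional_one by blast
  obtain g :: "'b \<Rightarrow> rat" where g: "\<And>x y. g (x + y) = g x + g y" "\<And>c x. g (scaleQ c x) = c * g x"
    "g 1 = 1" using ex_linear_functional_one by blast
  have f0: "f 0 = 0" using f(1)[of 0 0] by simp
  have *: "(\<Sum>x\<in>#X. f (fst x) * g (snd x)) = (\<Sum>x\<in>#Y. f (fst x) * g (snd x))"
    if "tensor_eq X Y" for X Y
    using that by induction (simp_all add: f g f0 algebra_simps)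
  assume "tensor_eq {#(1 :: 'a, 1 :: 'b)#} {#}"
  from *[OF this] show False by (simp add: f g)
qed

instantiation tensor :: (comm_rat_algebra, comm_rat_algebra) comm_ring_1
begin

lift_definition zero_tensor :: "('a, 'b) tensor" is "{#}" .
lift_definition one_tensor :: "('a, 'b) tensor" is "{#(1, 1)#}" .
lift_definition plus_tensor :: "('a, 'b) tensor \<Rightarrow> ('a, 'b) tensor \<Rightarrow> ('a, 'b) tensor"
  is "(+)" by (rule tensor_eq.add)
lift_definition times_tensor :: "('a, 'b) tensor \<Rightarrow> ('a, 'b) tensor \<Rightarrow> ('a, 'b) tensor"
  is tensor_times_raw by (rule tensor_eq_times)
lift_definition uminus_tensor :: "('a, 'b) tensor \<Rightarrow> ('a, 'b) tensor"
  is tensor_uminus_raw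
  unfolding tensor_uminus_raw_def by (rule tensor_eq_times[OF tensor_eq.refl])
definition minus_tensor :: "('a, 'b) tensor \<Rightarrow> ('a, 'b) tensor \<Rightarrow> ('a, 'b) tensor"
  where "minus_tensor x y = x + - y"

instance
proof
  fix x y z :: "('a, 'b) tensor"
  show "x + y + z = x + (y + z)"
    by transfer (simp add: add.assoc tensor_eq.refl)
  show "x + y = y + x"
    by transfer (simp add: add.commute tensor_eq.refl)
  show "0 + x = x"
    by transfer (simp add: tensor_eq.refl)
  show "- x + x = 0"
    by transfer (rule tensor_eq_uminus_add)
  show "x - y = x + - y"
    by (rule minus_tensor_def)
  show "x * y * z = x * (y * z)"
    by transfer (simp add: tensor_times_raw_assoc tensor_eq.refl)
  show "x * y = y * x"
    by transfer (simp add: tensor_times_raw_commute tensor_eq.refl)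
  show "1 * x = x"
    by transfer (simp add: tensor_times_raw_one tensor_eq.refl)
  show "(x + y) * z = x * z + y * z"
    by transfer (simp add: tensor_eq.refl)
  show "(0 :: ('a, 'b) tensor) \<noteq> 1"
    by transfer (use not_tensor_eq_one_zero tensor_eq.sym in blast)
qed

end

lemma pure_tensor_add_left: "(a + a') \<otimes>\<^sub>Q b = a \<otimes>\<^sub>Q b + a' \<otimes>\<^sub>Q b"
  by transfer (simp add: tensor_eq.add_left add_mset_commute)

lemma pure_tensor_add_right: "a \<otimes>\<^sub>Q (b + b') = a \<otimes>\<^sub>Q b + a \<otimes>\<^sub>Q b'"
  by transfer (simp add: tensor_eq.add_right add_mset_commute)

lemma pure_tensor_scale: "scaleQ c a \<otimes>\<^sub>Q b = a \<otimes>\<^sub>Q scaleQ c b"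
  by transfer (rule tensor_eq.scale)

lemma pure_tensor_zero_left [simp]: "0 \<otimes>\<^sub>Q b = 0"
  by transfer (rule tensor_eq.zero)

lemma pure_tensor_zero_right [simp]: "a \<otimes>\<^sub>Q 0 = 0"
  using pure_tensor_add_right[of a 0 0] by simp

lemma pure_tensor_mult: "(a \<otimes>\<^sub>Q b) * (a' \<otimes>\<^sub>Q b') = (a * a') \<otimes>\<^sub>Q (b * b')"
  by transfer (simp add: tensor_eq.refl)

lemma pure_tensor_one: "1 \<otimes>\<^sub>Q 1 = 1"
  by transfer (rule tensor_eq.refl)


section \<open>The ring \<open>A = R \<otimes>\<^sub>\<rat> \<rat>(q)\<close> and \<open>q\<close>-calculus\<close>

type_synonym ratfun = "rat poly fract"
type_synonym 'r qext = "('r, ratfun) tensor"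

definition qq :: ratfun where
  "qq = Fract [:0, 1:] 1"

definition qint :: "nat \<Rightarrow> ratfun" where
  "qint n = (\<Sum>i<n. qq ^ i)"

definition qfact :: "nat \<Rightarrow> ratfun" where
  "qfact n = (\<Prod>k=1..n. qint k)"

abbreviation of_ratfun :: "ratfun \<Rightarrow> 'r::comm_rat_algebra qext" where
  "of_ratfun x \<equiv> 1 \<otimes>\<^sub>Q x"

definition qdilate :: "'r::comm_rat_algebra qext fps \<Rightarrow> 'r qext fps" where
  "qdilate F = F oo (fps_const (of_ratfun qq) * fps_X)"

text \<open>\<^term>\<open>fps_shift 1\<close> divides by \<open>t\<close> a series with zero constant term.\<close>

definition qderiv :: "'r::comm_rat_algebra qext fps \<Rightarrow> 'r qext fps" where
  "qderiv F = fps_shift 1 (fps_const (of_ratfun (inverse (qq - 1))) * (qdilate F - F))"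

primrec qstar_power :: "'r::comm_rat_algebra qext fps \<Rightarrow> nat \<Rightarrow> 'r qext fps" where
  "qstar_power F 0 = 1"
| "qstar_power F (Suc k) =
     (THE G. fps_nth G 0 = 0 \<and>
        qderiv G = fps_const (of_ratfun (qint (Suc k) * inverse (qq ^ k)))
                     * qdilate (qstar_power F k) * qderiv F)"

text \<open>For \<open>G = \<Sum>k. g\<^sub>k t\<^sup>k / [k]\<^sub>q!\<close> the coefficient \<^term>\<open>fps_nth G k\<close> is \<open>g\<^sub>k / [k]\<^sub>q!\<close>.  The
  infinite sum is taken in the \<open>t\<close>-adic topology.\<close>

definition qstar_compose :: "'r::comm_rat_algebra qext fps \<Rightarrow> 'r qext fps \<Rightarrow> 'r qext fps" where
  "qstar_compose G F = (\<Sum>k. fps_const (fps_nth G k) * qstar_power F k)"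

definition qExp :: "'r::comm_rat_algebra qext fps" where
  "qExp = Abs_fps (\<lambda>n. of_ratfun (qq ^ (n choose 2) / qfact n))"


section \<open>Well-definedness of the \<open>q\<^sup>*\<close>-powers\<close>

lemma qdilate_nth: "fps_nth (qdilate F) n = of_ratfun (qq ^ n) * fps_nth F n"
proof -
  have "(1 \<otimes>\<^sub>Q qq) ^ n = (1 \<otimes>\<^sub>Q (qq ^ n) :: 'a qext)"
    by (induction n) (simp_all add: pure_tensor_one pure_tensor_mult)
  then show ?thesis
    by (simp add: qdilate_def fps_compose_linear)
qed

lemma qq_power_neq_1: "n > 0 \<Longrightarrow> qq ^ n \<noteq> 1"
proof
  assume n: "n > 0" "qq ^ n = 1"
  have "qq ^ n = Fract (monom 1 n) 1"
    by (induction n)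
      (simp_all add: qq_def One_fract_def monom_Suc one_pCons[symmetric] monom_0)
  with n have "(monom 1 n :: rat poly) = 1"
    by (simp add: One_fract_def eq_fract)
  then have "degree (monom (1 :: rat) n) = 0" by simp
  with n show False by (simp add: degree_monom_eq)
qed

lemma qint_eq: "qint n = (qq ^ n - 1) / (qq - 1)"
  unfolding qint_def using geometric_sum[of qq n] qq_power_neq_1[of 1] by simp

lemma qint_neq_0: "n > 0 \<Longrightarrow> qint n \<noteq> 0"
  using qq_power_neq_1[of n] qq_power_neq_1[of 1] by (simp add: qint_eq)

lemma qderiv_nth: "fps_nth (qderiv F) n = of_ratfun (qint (Suc n)) * fps_nth F (Suc n)"
proof -
  have "(1 \<otimes>\<^sub>Q qint (Suc n) :: 'a qext) = (1 \<otimes>\<^sub>Q inverse (qq - 1)) * (1 \<otimes>\<^sub>Q (qq ^ Suc n) - 1)"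
  proof -
    have "1 \<otimes>\<^sub>Q (qq ^ Suc n) = (1 \<otimes>\<^sub>Q (qq ^ Suc n - 1) :: 'a qext) + 1 \<otimes>\<^sub>Q 1"
      by (simp flip: pure_tensor_add_right)
    then have "1 \<otimes>\<^sub>Q (qq ^ Suc n) - 1 = (1 \<otimes>\<^sub>Q (qq ^ Suc n - 1) :: 'a qext)"
      by (simp add: pure_tensor_one)
    then show ?thesis
      by (simp add: pure_tensor_mult qint_eq field_simps)
  qed
  then have "of_ratfun (qint (Suc n)) * fps_nth F (Suc n) =
      of_ratfun (inverse (qq - 1)) * ((of_ratfun (qq ^ Suc n) - 1) * fps_nth F (Suc n))"
    by (simp only: mult.assoc)
  then show ?thesis
    by (simp add: qderiv_def qdilate_nth left_diff_distrib)
qed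

lemma ex1_qderiv: "\<exists>!G. fps_nth G 0 = 0 \<and> qderiv G = (H :: 'r::comm_rat_algebra qext fps)"
proof -
  have inv: "of_ratfun (qint (Suc n)) * of_ratfun (inverse (qint (Suc n))) = (1 :: 'r qext)" for n
    by (simp add: pure_tensor_mult qint_neq_0 pure_tensor_one)
  show ?thesis
  proof
    show "fps_nth (Abs_fps (\<lambda>n. case n of 0 \<Rightarrow> 0
        | Suc m \<Rightarrow> of_ratfun (inverse (qint (Suc m))) * fps_nth H m)) 0 = 0 \<and>
      qderiv (Abs_fps (\<lambda>n. case n of 0 \<Rightarrow> 0
        | Suc m \<Rightarrow> of_ratfun (inverse (qint (Suc m))) * fps_nth H m)) = H"
      by (simp add: fps_eq_iff qderiv_nth inv flip: mult.assoc)
  next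
    fix G assume G: "fps_nth G 0 = 0 \<and> qderiv G = H"
    show "G = Abs_fps (\<lambda>n. case n of 0 \<Rightarrow> 0
        | Suc m \<Rightarrow> of_ratfun (inverse (qint (Suc m))) * fps_nth H m)"
    proof (rule fps_ext)
      fix n show "fps_nth G n = fps_nth (Abs_fps (\<lambda>n. case n of 0 \<Rightarrow> 0
        | Suc m \<Rightarrow> of_ratfun (inverse (qint (Suc m))) * fps_nth H m)) n"
      proof (cases n)
        case (Suc m)
        have "fps_nth H m = of_ratfun (qint (Suc m)) * fps_nth G (Suc m)"
          using G by (metis qderiv_nth)
        then have "of_ratfun (inverse (qint (Suc m))) * fps_nth H m =
            (of_ratfun (qint (Suc m)) * of_ratfun (inverse (qint (Suc m)))) * fps_nth G (Suc m)"
          by (simp only: ac_simps)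
        then show ?thesis
          by (simp only: inv) (simp add: Suc)
      qed (use G in simp)
    qed
  qed
qed

lemma qstar_power_Suc:
  "fps_nth (qstar_power F (Suc k)) 0 = 0"
  "qderiv (qstar_power F (Suc k)) =
     fps_const (of_ratfun (qint (Suc k) * inverse (qq ^ k)))
       * qdilate (qstar_power F k) * qderiv F"
  unfolding qstar_power.simps using theI'[OF ex1_qderiv] by blast+

lemma qstar_power_nth_eq_0: "n < k \<Longrightarrow> fps_nth (qstar_power F k) n = 0"
proof (induction k arbitrary: n)
  case (Suc k)
  show ?case
  proof (cases n)
    case (Suc m)
    have "fps_nth (qdilate (qstar_power F k) * qderiv F) m = 0"
      unfolding fps_mult_nth using Suc Suc.prems Suc.IH
      by (intro sum.neutral) (auto simp: qdilate_nth)
    then have "of_ratfun (qint (Suc m)) * fps_nth (qstar_power F (Suc k)) (Suc m) = 0"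
      by (simp only: qderiv_nth[symmetric] qstar_power_Suc(2) mult.assoc fps_mult_left_const_nth
          mult_zero_right)
    then have "(of_ratfun (inverse (qint (Suc m))) * of_ratfun (qint (Suc m)))
        * fps_nth (qstar_power F (Suc k)) (Suc m) = 0"
      by (simp only: mult.assoc mult_zero_right)
    moreover have "of_ratfun (inverse (qint (Suc m))) * of_ratfun (qint (Suc m)) = (1 :: 'a qext)"
      by (simp add: pure_tensor_mult qint_neq_0 pure_tensor_one)
    ultimately show ?thesis
      by (simp only: Suc mult_1_left)
  qed (simp only: qstar_power_Suc(1))
qed simp

lemma qstar_compose_sums:
  "(\<lambda>k. fps_const (fps_nth G k) * qstar_power F k) sums qstar_compose G F"
proof -
  have "(\<lambda>k. fps_const (fps_nth G k) * qstar_power F k) sums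
      Abs_fps (\<lambda>n. \<Sum>k\<le>n. fps_nth G k * fps_nth (qstar_power F k) n)"
    unfolding sums_def
  proof (rule tendsto_fpsI)
    fix n
    have "fps_nth (\<Sum>k<N. fps_const (fps_nth G k) * qstar_power F k) n =
        (\<Sum>k\<le>n. fps_nth G k * fps_nth (qstar_power F k) n)" if "N > n" for N
      unfolding fps_sum_nth fps_mult_left_const_nth
      using that by (intro sum.mono_neutral_right) (auto simp: qstar_power_nth_eq_0)
    then show "\<forall>\<^sub>F N in sequentially. fps_nth (\<Sum>k<N. fps_const (fps_nth G k) * qstar_power F k) n =
        fps_nth (Abs_fps (\<lambda>n. \<Sum>k\<le>n. fps_nth G k * fps_nth (qstar_power F k) n)) n"
      by (auto intro: eventually_mono[OF eventually_gt_at_top[of n]])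
  qed
  then show ?thesis
    unfolding qstar_compose_def by (intro summable_sums sums_summable)
qed

end

theory Submission imports Defs begin

text \<open>Cut a permutation of \<open>{1..n+1}\<close> before its greatest letter: \<open>\<pi> = \<sigma>\<beta>\<close> with \<open>\<beta>\<close> basic.  If
  \<open>\<sigma>\<close> has content \<open>E\<close>, then \<open>\<omega>(\<pi>) = \<omega>(\<sigma>) \<omega>(\<beta>)\<close>, and the non-inversions of \<open>\<pi>\<close> between \<open>\<sigma>\<close>
  and \<open>\<beta>\<close> depend only on \<open>E\<close>.  Summing over all \<open>E\<close> with \<open>k\<close> elements gives \<open>q\<^sup>k\<close> times a
  \<open>q\<close>-binomial coefficient, so that the generating function \<open>\<Gamma>\<close> of the \<open>\<gamma>\<^sub>n\<close> satisfies
  \<open>D\<^sub>q\<Gamma>(t) = \<Gamma>(qt) D\<^sub>qF(t)\<close>.  The series \<open>E\<^sub>q[F]\<^sup>*\<close> satisfies the same equation, termwise by the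
  definition of the \<open>q\<^sup>*\<close>-powers, and a solution is determined by its constant term.\<close>

section \<open>Scalars from Q(q) in the tensor product\<close>

lemma of_ratfun_mult: "of_ratfun (x * y) = (of_ratfun x * of_ratfun y :: 'r::comm_rat_algebra qext)"
  by (simp add: pure_tensor_mult)

lemma of_ratfun_sum: "of_ratfun (\<Sum>i\<in>A. g i) = (\<Sum>i\<in>A. of_ratfun (g i) :: 'r::comm_rat_algebra qext)"
  by (induction A rule: infinite_finite_induct) (simp_all add: pure_tensor_add_right)

text \<open>The tensor product may have zero divisors, since \<open>'r\<close> is an arbitrary
  commutative algebra. Scalars from the field Q(q) can still be cancelled, because their inverses
  are available there.\<close>

lemma of_ratfun_inverse_cancel:
  assumes "c \<noteq> 0" "of_ratfun c * x = of_ratfun c * (y :: 'r::comm_rat_algebra qext)"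
  shows "x = y"
proof -
  have "of_ratfun (inverse c) * (of_ratfun c * x) = of_ratfun (inverse c) * (of_ratfun c * y)"
    using assms(2) by simp
  then show ?thesis
    using assms(1) by (simp add: pure_tensor_mult pure_tensor_one flip: mult.assoc)
qed

section \<open>\<open>q\<close>-binomial coefficients\<close>

lemma qint_add: "qint (a + b) = qint a + qq ^ a * qint b"
  by (induction b) (simp_all add: qint_def algebra_simps power_add)

lemma qfact_Suc: "qfact (Suc n) = qint (Suc n) * qfact n"
  by (simp add: qfact_def)

lemma qfact_0 [simp]: "qfact 0 = 1"
  by (simp add: qfact_def)

lemma qfact_neq_0: "qfact n \<noteq> 0"
  by (simp add: qfact_def qint_neq_0)

text \<open>For the letter sets of two words these are the non-inversions across a concatenation;
  they do not depend on the order of the letters within either factor.\<close>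

definition ascending_pairs :: "nat set \<Rightarrow> nat set \<Rightarrow> nat" where
  "ascending_pairs A B = card {(x, y). x \<in> A \<and> y \<in> B \<and> x < y}"

lemma ascending_pairs_insert_top_left:
  assumes "\<And>y. y \<in> B \<Longrightarrow> y < m"
  shows "ascending_pairs (insert m A) B = ascending_pairs A B"
  unfolding ascending_pairs_def using assms by (intro arg_cong[where f = card]) force

lemma ascending_pairs_insert_top_right:
  assumes "\<And>x. x \<in> A \<Longrightarrow> x < m" "finite A" "finite B" "m \<notin> B"
  shows "ascending_pairs A (insert m B) = ascending_pairs A B + card A"
proof -
  have "{(x, y). x \<in> A \<and> y \<in> insert m B \<and> x < y} =
      {(x, y). x \<in> A \<and> y \<in> B \<and> x < y} \<union> A \<times> {m}"
    using assms(1) by auto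
  moreover have "finite {(x, y). x \<in> A \<and> y \<in> B \<and> x < y}"
    by (rule finite_subset[of _ "A \<times> B"]) (use assms in auto)
  moreover have "{(x, y). x \<in> A \<and> y \<in> B \<and> x < y} \<inter> A \<times> {m} = {}"
    using assms(4) by auto
  ultimately show ?thesis
    using assms(2) by (simp add: ascending_pairs_def card_Un_disjoint card_cartesian_product)
qed

text \<open>The Gaussian binomial coefficient, in the form in which it arises from the choice of the
  letters that precede the greatest one.\<close>

definition qsubsets :: "nat \<Rightarrow> nat \<Rightarrow> ratfun" where
  "qsubsets n k = (\<Sum>E | E \<subseteq> {1..n} \<and> card E = k. qq ^ ascending_pairs E ({1..n} - E))"

lemma qsubsets_0: "qsubsets n 0 = 1"
proof -
  have "{E. E \<subseteq> {1..n} \<and> card E = 0} = {{}}"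
    using finite_subset[of _ "{1..n}"] by auto
  then show ?thesis by (simp add: qsubsets_def ascending_pairs_def)
qed

lemma qsubsets_eq_0: "n < k \<Longrightarrow> qsubsets n k = 0"
proof -
  assume "n < k"
  then have "card E \<noteq> k" if "E \<subseteq> {1..n}" for E
    using card_mono[OF _ that] by simp
  then have "{E. E \<subseteq> {1..n} \<and> card E = k} = {}" by blast
  then show ?thesis by (simp only: qsubsets_def sum.empty)
qed

text \<open>The q-Pascal rule, by cases on whether \<open>Suc n\<close> lies in \<open>E\<close>.
  Inside \<open>E\<close> it is above the whole complement and creates no pair; in the complement it
  is above all \<open>Suc k\<close> elements of \<open>E\<close>, which gives the factor
  \<open>qq ^ Suc k\<close>.\<close>

lemma qsubsets_Suc_Suc: "qsubsets (Suc n) (Suc k) = qsubsets n k + qq ^ Suc k * qsubsets n (Suc k)"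
proof -
  let ?S = "\<lambda>n k. {E. E \<subseteq> {1..n} \<and> card E = k}"
  let ?w = "\<lambda>n E. qq ^ ascending_pairs E ({1..n} - E)"
  have fin: "finite E" "Suc n \<notin> E" if "E \<subseteq> {1..n}" for E
    using that finite_subset[of E "{1..n}"] by auto
  have S: "?S (Suc n) (Suc k) = insert (Suc n) ` ?S n k \<union> ?S n (Suc k)" (is "?L = ?R")
  proof (intro subset_antisym subsetI)
    fix E assume E: "E \<in> ?L"
    show "E \<in> ?R"
    proof (cases "Suc n \<in> E")
      case True
      then have "E = insert (Suc n) (E - {Suc n})" "E - {Suc n} \<subseteq> {1..n}" "card (E - {Suc n}) = k"
        using E by (auto simp: atLeastAtMostSuc_conv)
      then show ?thesis by blast
    next
      case False
      then show ?thesis using E by (auto simp: atLeastAtMostSuc_conv)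
    qed
  next
    fix E assume "E \<in> ?R"
    then show "E \<in> ?L"
      using fin by (auto simp: atLeastAtMostSuc_conv)
  qed
  have finS: "finite (?S n k)" for k
    by (rule finite_subset[of _ "Pow {1..n}"]) auto
  have inj: "inj_on (insert (Suc n)) (?S n k)"
    using fin(2) by (intro inj_onI) (metis (mono_tags, lifting) insert_ident mem_Collect_eq)
  have w1: "?w (Suc n) (insert (Suc n) E) = ?w n E" if "E \<in> ?S n k" for E
  proof -
    have "{1..Suc n} - insert (Suc n) E = {1..n} - E" by (auto simp: atLeastAtMostSuc_conv)
    then show ?thesis
      using ascending_pairs_insert_top_left[of "{1..n} - E" "Suc n" E] by simp
  qed
  have w2: "?w (Suc n) E = qq ^ Suc k * ?w n E" if "E \<in> ?S n (Suc k)" for E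
  proof -
    have "{1..Suc n} - E = insert (Suc n) ({1..n} - E)"
      using that by (auto simp: atLeastAtMostSuc_conv)
    moreover have "ascending_pairs E (insert (Suc n) ({1..n} - E)) =
        ascending_pairs E ({1..n} - E) + card E"
      using that fin by (intro ascending_pairs_insert_top_right) auto
    ultimately show ?thesis using that by (simp add: power_add)
  qed
  have "qsubsets (Suc n) (Suc k) =
      (\<Sum>E\<in>insert (Suc n) ` ?S n k. ?w (Suc n) E) + (\<Sum>E\<in>?S n (Suc k). ?w (Suc n) E)"
    unfolding qsubsets_def S using fin(2) finS by (intro sum.union_disjoint) auto
  also have "(\<Sum>E\<in>insert (Suc n) ` ?S n k. ?w (Suc n) E) = qsubsets n k"
    unfolding sum.reindex[OF inj] qsubsets_def o_def by (rule sum.cong[OF HOL.refl w1])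
  also have "(\<Sum>E\<in>?S n (Suc k). ?w (Suc n) E) = qq ^ Suc k * qsubsets n (Suc k)"
    unfolding qsubsets_def sum_distrib_left by (rule sum.cong[OF HOL.refl w2])
  finally show ?thesis .
qed

text \<open>Induction by the q-Pascal rule: with k = j + 1, its two summands contribute the factors
  [j+1] and q^(j+1) [n-j], which add up to [n+1] by \<open>qint_add\<close>.\<close>

lemma qsubsets_qfact: "k \<le> n \<Longrightarrow> qsubsets n k * (qfact k * qfact (n - k)) = qfact n"
proof (induction n arbitrary: k)
  case (Suc n)
  show ?case
  proof (cases k)
    case (Suc j)
    have 1: "qsubsets n j * (qfact j * qfact (n - j)) = qfact n"
      using Suc Suc.prems by (intro Suc.IH) simp
    have 2: "qsubsets n (Suc j) * (qfact (Suc j) * qfact (n - j)) = qint (n - j) * qfact n"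
    proof (cases "j < n")
      case True
      then have "qfact (n - j) = qint (n - j) * qfact (n - Suc j)"
        by (metis Suc_diff_Suc qfact_Suc)
      then show ?thesis using Suc.IH[of "Suc j"] True by (simp add: ac_simps)
    next
      \<comment> \<open>Here \<open>j = n\<close>, and both sides vanish: there is no subset of size
        n + 1, and \<open>qint 0 = 0\<close>.\<close>
      case False
      then show ?thesis using Suc Suc.prems by (simp add: qsubsets_eq_0 qint_def)
    qed
    have "qsubsets (Suc n) k * (qfact k * qfact (Suc n - k)) =
        qint (Suc j) * (qsubsets n j * (qfact j * qfact (n - j))) +
        qq ^ Suc j * (qsubsets n (Suc j) * (qfact (Suc j) * qfact (n - j)))"
      by (simp add: Suc qsubsets_Suc_Suc qfact_Suc algebra_simps del: power_Suc)
    also have "\<dots> = (qint (Suc j) + qq ^ Suc j * qint (n - j)) * qfact n"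
      unfolding 1 2 by (simp add: algebra_simps)
    also have "\<dots> = qfact (Suc n)"
      using Suc Suc.prems unfolding qint_add[symmetric] by (simp add: qfact_Suc)
    finally show ?thesis .
  qed (simp add: qsubsets_0)
qed (simp add: qsubsets_0)

section \<open>Words\<close>

text \<open>Pairs of positions starting at 0 are separated from the shifted pairs of
  \<open>w\<close>. Distinctness allows the former to be counted by letters instead of
  positions.\<close>

lemma noninversions_Cons:
  assumes "distinct w"
  shows "noninversions (x # w) = ascending_pairs {x} (set w) + noninversions w"
proof -
  let ?A = "{(i, j). i < j \<and> j < length w \<and> w ! i < w ! j}"
  let ?J = "{j. j < length w \<and> x < w ! j}"
  have "{(i, j). i < j \<and> j < length (x # w) \<and> (x # w) ! i < (x # w) ! j} =
      (\<lambda>j. (0, Suc j)) ` ?J \<union> map_prod Suc Suc ` ?A" (is "?L = ?R")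
  proof (intro subset_antisym subsetI)
    fix p assume "p \<in> ?L"
    then obtain i j where p: "p = (i, Suc j)" "i < Suc j" "j < length w" "(x # w) ! i < w ! j"
      by (cases p; cases "snd p") auto
    show "p \<in> ?R"
      using p by (cases i) (auto simp: image_iff)
  qed auto
  moreover have "finite ?A"
    by (rule finite_subset[of _ "{..<length w} \<times> {..<length w}"]) auto
  moreover have "inj_on (\<lambda>j. (0 :: nat, Suc j)) ?J" "inj_on (map_prod Suc Suc) ?A"
    by (auto intro!: inj_onI)
  moreover have "(\<lambda>j. (0, Suc j)) ` ?J \<inter> map_prod Suc Suc ` ?A = {}" by auto
  ultimately have "noninversions (x # w) = card ?J + noninversions w"
    unfolding noninversions_def by (simp add: card_Un_disjoint card_image)
  moreover have "card ?J = card ((\<lambda>j. (x, w ! j)) ` ?J)"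
    using assms by (intro card_image[symmetric] inj_onI) (auto simp: nth_eq_iff_index_eq)
  moreover have "(\<lambda>j. (x, w ! j)) ` ?J = {(a, b). a \<in> {x} \<and> b \<in> set w \<and> a < b}"
    by (auto simp: in_set_conv_nth)
  ultimately show ?thesis by (simp add: ascending_pairs_def)
qed

lemma ascending_pairs_Un_left:
  assumes "finite A" "finite A'" "finite B" "A \<inter> A' = {}"
  shows "ascending_pairs (A \<union> A') B = ascending_pairs A B + ascending_pairs A' B"
proof -
  have "{(x, y). x \<in> A \<union> A' \<and> y \<in> B \<and> x < y} =
      {(x, y). x \<in> A \<and> y \<in> B \<and> x < y} \<union> {(x, y). x \<in> A' \<and> y \<in> B \<and> x < y}" by auto
  moreover have "finite {(x, y). x \<in> C \<and> y \<in> B \<and> x < y}" if "finite C" for C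
    by (rule finite_subset[of _ "C \<times> B"]) (use assms that in auto)
  ultimately show ?thesis
    using assms unfolding ascending_pairs_def by (simp add: card_Un_disjoint disjoint_iff)
qed

lemma ascending_pairs_Un_right:
  assumes "finite A" "finite B" "finite B'" "B \<inter> B' = {}"
  shows "ascending_pairs A (B \<union> B') = ascending_pairs A B + ascending_pairs A B'"
proof -
  have "{(x, y). x \<in> A \<and> y \<in> B \<union> B' \<and> x < y} =
      {(x, y). x \<in> A \<and> y \<in> B \<and> x < y} \<union> {(x, y). x \<in> A \<and> y \<in> B' \<and> x < y}" by auto
  moreover have "finite {(x, y). x \<in> A \<and> y \<in> C \<and> x < y}" if "finite C" for C
    by (rule finite_subset[of _ "A \<times> C"]) (use assms that in auto)
  ultimately show ?thesis
    using assms unfolding ascending_pairs_def by (simp add: card_Un_disjoint disjoint_iff)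
qed

lemma noninversions_append:
  "distinct (u @ v) \<Longrightarrow>
    noninversions (u @ v) = ascending_pairs (set u) (set v) + noninversions u + noninversions v"
proof (induction u)
  case Nil
  then show ?case by (simp add: noninversions_def ascending_pairs_def)
next
  case (Cons x u)
  have "ascending_pairs (set (x # u)) (set v) =
      ascending_pairs {x} (set v) + ascending_pairs (set u) (set v)"
    using ascending_pairs_Un_left[of "{x}" "set u" "set v"] Cons.prems by simp
  with Cons show ?case
    by (simp add: noninversions_Cons ascending_pairs_Un_right)
qed

lemma noninversions_map:
  assumes "strict_mono_on (set w) g"
  shows "noninversions (map g w) = noninversions w"
proof -
  have "w ! i < w ! j \<longleftrightarrow> g (w ! i) < g (w ! j)" if "i < j" "j < length w" for i j
    using that strict_mono_on_less[OF assms, of "w ! i" "w ! j"] by simp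
  then show ?thesis
    unfolding noninversions_def by (intro arg_cong[where f = card]) auto
qed

section \<open>The decomposition of a word that ends in a basic factor\<close>

lemma lr_max_positions_append_basic:
  assumes "basic b" "\<forall>x\<in>set w. x < hd b"
  shows "lr_max_positions (w @ b) = insert (length w) (lr_max_positions w)"
proof -
  have b: "b \<noteq> []" "distinct b" "hd b = b ! 0" and hd: "\<And>y. y \<in> set b \<Longrightarrow> y \<le> hd b"
    using assms(1) by (auto simp: basic_def hd_conv_nth)
  \<comment> \<open>Position \<open>length w\<close> carries \<open>hd b\<close>, the greatest
    letter of \<open>b\<close>, so no later letter can exceed everything to its left.\<close>
  have "i \<notin> lr_max_positions (w @ b)" if "i > length w" for i
  proof
    assume i: "i \<in> lr_max_positions (w @ b)"
    then have "(w @ b) ! length w < (w @ b) ! i" "i < length w + length b"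
      using that by (auto simp: lr_max_positions_def)
    then have "hd b < b ! (i - length w)" "i - length w < length b"
      using b that by (auto simp: nth_append)
    then show False using hd[OF nth_mem, of "i - length w"] by simp
  qed
  moreover have "length w \<in> lr_max_positions (w @ b)"
    using b assms(2) by (auto simp: lr_max_positions_def nth_append)
  moreover have "i \<in> lr_max_positions (w @ b) \<longleftrightarrow> i \<in> lr_max_positions w" if "i < length w" for i
    using that by (auto simp: lr_max_positions_def nth_append)
  ultimately show ?thesis
    by (auto simp: lr_max_positions_def set_eq_iff) (metis linorder_neqE_nat)+
qed

text \<open>The only new cut is at \<open>length w\<close>. It takes over the role that the end of
  the word had for the last factor of \<open>w\<close>, so the factors of \<open>w\<close> survive
  and \<open>b\<close> is added.\<close>

lemma basic_decomposition_append_basic: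
  assumes "basic b" "\<forall>x\<in>set w. x < hd b"
  shows "basic_decomposition (w @ b) = insert b (basic_decomposition w)"
proof -
  let ?L = "lr_max_positions w" and ?n = "length w"
  note L = lr_max_positions_append_basic[OF assms]
  have b: "length b > 0" using assms(1) by (simp add: basic_def)
  have less: "i < ?n" if "i \<in> ?L" for i using that by (simp add: lr_max_positions_def)
  show ?thesis
  proof (intro subset_antisym subsetI)
    fix u assume "u \<in> basic_decomposition (w @ b)"
    then have "\<exists>i j. u = take (j - i) (drop i (w @ b)) \<and> i \<in> insert ?n ?L \<and>
        j \<in> insert (?n + length b) (insert ?n ?L) \<and> i < j \<and>
        (\<forall>k\<in>insert ?n ?L. \<not> (i < k \<and> k < j))"
      unfolding basic_decomposition_def mem_Collect_eq L length_append .
    then obtain i j where u: "u = take (j - i) (drop i (w @ b))"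
      and ij: "i \<in> insert ?n ?L" "j \<in> insert (?n + length b) (insert ?n ?L)" "i < j"
        "\<forall>k\<in>insert ?n ?L. \<not> (i < k \<and> k < j)"
      by (elim exE conjE)
    show "u \<in> insert b (basic_decomposition w)"
    proof (cases "i = ?n")
      case True
      then have "j = ?n + length b" using ij less by force
      then show ?thesis using u True by simp
    next
      case False
      then have i: "i \<in> ?L" "i < ?n" using ij less by auto
      \<comment> \<open>Otherwise the cut at \<open>?n\<close> would lie strictly between
        \<open>i\<close> and \<open>j\<close>.\<close>
      then have "j \<noteq> ?n + length b" using ij(4) b by auto
      then have j: "j \<in> insert ?n ?L" "j \<le> ?n" using ij(2) less by force+
      then have "u = take (j - i) (drop i w)" using u i by simp
      then show ?thesis using i j ij unfolding basic_decomposition_def by blast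
    qed
  next
    fix u assume "u \<in> insert b (basic_decomposition w)"
    then consider "u = b" | i j where "u = take (j - i) (drop i w)" "i \<in> ?L" "j \<in> insert ?n ?L"
        "i < j" "\<forall>k\<in>?L. \<not> (i < k \<and> k < j)"
      unfolding basic_decomposition_def by auto
    then show "u \<in> basic_decomposition (w @ b)"
    proof cases
      case 1
      show ?thesis
        unfolding basic_decomposition_def L mem_Collect_eq
        by (rule exI[of _ ?n], rule exI[of _ "?n + length b"]) (use 1 b less in force)
    next
      case (2 i j)
      then have "j \<le> ?n" using less by force
      then show ?thesis
        unfolding basic_decomposition_def L mem_Collect_eq
        by (intro exI[of _ i] exI[of _ j]) (use 2 less in auto)
    qed
  qed
qed

text \<open>Finiteness is what allows the factor for \<open>b\<close> to be split off from the
  product; over an infinite set \<Prod> is 1 by convention.\<close>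

lemma finite_basic_decomposition: "finite (basic_decomposition w)"
proof (rule finite_subset)
  show "basic_decomposition w \<subseteq> (\<Union>i\<le>length w. \<Union>j\<le>length w. {take (j - i) (drop i w)})"
  proof
    fix u assume "u \<in> basic_decomposition w"
    then obtain i j where ij: "u = take (j - i) (drop i w)"
      "i \<in> lr_max_positions w" "j \<in> insert (length w) (lr_max_positions w)"
      unfolding basic_decomposition_def mem_Collect_eq by (elim exE conjE)
    then have "i \<le> length w" "j \<le> length w" by (auto simp: lr_max_positions_def)
    with ij(1) show "u \<in> (\<Union>i\<le>length w. \<Union>j\<le>length w. {take (j - i) (drop i w)})" by blast
  qed
qed simp

lemma multiplicative_fun_append_basic:
  assumes "multiplicative_fun \<omega>" "distinct (w @ b)" "basic b" "\<forall>x\<in>set w. x < hd b"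
  shows "\<omega> (w @ b) = \<omega> w * \<omega> b"
proof -
  have prod: "\<omega> u = (\<Prod>\<beta>\<in>basic_decomposition u. \<omega> \<beta>)" if "distinct u" for u
    using assms(1) that unfolding multiplicative_fun_def by blast
  \<comment> \<open>The decomposition is a set, so a repeated factor would be counted once only. The
    head of \<open>b\<close> is above all letters of \<open>w\<close>, which excludes this.\<close>
  have "b \<notin> basic_decomposition w"
  proof
    assume "b \<in> basic_decomposition w"
    then have "set b \<subseteq> set w"
      by (auto simp: basic_decomposition_def dest: in_set_takeD in_set_dropD)
    moreover have "hd b \<in> set b" using assms(3) by (simp add: basic_def)
    ultimately show False using assms(4) by blast
  qed
  then have "\<omega> (w @ b) = \<omega> b * (\<Prod>\<beta>\<in>basic_decomposition w. \<omega> \<beta>)"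
    unfolding prod[OF assms(2)] basic_decomposition_append_basic[OF assms(3,4)]
    by (simp add: finite_basic_decomposition)
  then show ?thesis using prod[of w] assms(2) by (simp add: mult.commute)
qed

lemma multiplicative_fun_Nil:
  assumes "multiplicative_fun \<omega>"
  shows "\<omega> [] = 1"
proof -
  have "\<omega> [] = (\<Prod>\<beta>\<in>basic_decomposition []. \<omega> \<beta>)"
    using assms unfolding multiplicative_fun_def by (metis distinct.simps(1))
  then show ?thesis by (simp add: basic_decomposition_def lr_max_positions_def)
qed

section \<open>The recursion for the \<open>\<gamma>\<^sub>n\<close>\<close>

text \<open>The common summand of the two sums that define \<gamma> and \<open>f\<close> in the
  theorem.\<close>

definition weight :: "(nat list \<Rightarrow> 'r::comm_rat_algebra) \<Rightarrow> nat list \<Rightarrow> 'r qext" where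
  "weight \<omega> w = \<omega> w \<otimes>\<^sub>Q qq ^ noninversions w"

section \<open>Reduction as an order-preserving relabelling\<close>

lemma strict_mono_on_rank: "finite E \<Longrightarrow> strict_mono_on E (\<lambda>x. card {y \<in> E. y \<le> x})"
  for E :: "nat set"
proof (rule strict_mono_onI, rule psubset_card_mono, simp, rule psubsetI)
  fix r s assume "s \<in> E" "r < s"
  then have "s \<in> {y \<in> E. y \<le> s}" "s \<notin> {y \<in> E. y \<le> r}" by auto
  then show "{y \<in> E. y \<le> r} \<noteq> {y \<in> E. y \<le> s}" by blast
qed auto

lemma rank_image: "finite E \<Longrightarrow> (\<lambda>x. card {y \<in> E. y \<le> x}) ` E = {1..card E}" for E :: "nat set"
proof (rule card_subset_eq)
  let ?r = "\<lambda>x. card {y \<in> E. y \<le> x}"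
  assume E: "finite E"
  have "1 \<le> ?r x" if "x \<in> E" for x
    using E that by (auto simp: Suc_le_eq card_gt_0_iff)
  moreover have "?r x \<le> card E" for x
    using E by (intro card_mono) auto
  ultimately show "?r ` E \<subseteq> {1..card E}" by auto
  show "card (?r ` E) = card {1..card E}"
    using strict_mono_on_rank[OF E] by (simp add: card_image strict_mono_on_imp_inj_on)
qed simp

text \<open>On all words with content \<open>E\<close>, \<open>red\<close> applies one and the same
  rank function letter by letter, and this function maps \<open>E\<close> bijectively onto {1..card
  E}.\<close>

lemma red_image: "finite E \<Longrightarrow> red ` permutations_of_set E = perms (card E)"
proof -
  let ?r = "\<lambda>x. card {y \<in> E. y \<le> x}"
  assume E: "finite E"
  have "red ` permutations_of_set E = map ?r ` permutations_of_set E"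
    by (rule image_cong) (auto simp: red_def permutations_of_set_def)
  also have "\<dots> = permutations_of_set (?r ` E)"
    using strict_mono_on_rank[OF E]
    by (simp add: permutations_of_set_image_inj strict_mono_on_imp_inj_on)
  finally show ?thesis using rank_image[OF E] by (simp add: perms_def)
qed

lemma inj_on_red: "finite E \<Longrightarrow> inj_on red (permutations_of_set E)"
proof (rule inj_onI)
  let ?r = "\<lambda>x. card {y \<in> E. y \<le> x}"
  fix u v assume "finite E" "u \<in> permutations_of_set E" "v \<in> permutations_of_set E" "red u = red v"
  then have "map ?r u = map ?r v" "set u = E" "set v = E" "inj_on ?r E"
    using strict_mono_on_rank[of E]
    by (auto simp: red_def permutations_of_set_def strict_mono_on_imp_inj_on)
  then show "u = v" using inj_on_map_eq_map[of ?r u v] by simp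
qed

lemma noninversions_red: "noninversions (red w) = noninversions w"
  unfolding red_def by (intro noninversions_map strict_mono_on_rank) simp

lemma basic_iff: "basic v \<longleftrightarrow> distinct v \<and> v \<noteq> [] \<and> (\<forall>x\<in>set v. x \<le> hd v)"
  unfolding basic_def by (metis List.finite_set Max_eqI Max_ge hd_in_set)

lemma basic_red_iff: "distinct w \<Longrightarrow> basic (red w) \<longleftrightarrow> basic w"
proof (cases w)
  case (Cons a u)
  let ?r = "\<lambda>x. card {y \<in> set w. y \<le> x}"
  assume w: "distinct w"
  have m: "strict_mono_on (set w) ?r" by (rule strict_mono_on_rank) simp
  have "distinct (red w)"
    using w m by (simp add: red_def distinct_map strict_mono_on_imp_inj_on)
  moreover have "hd (red w) = ?r a" "set (red w) = ?r ` set w" "red w \<noteq> []" "w \<noteq> []" "hd w = a"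
    using Cons by (simp_all add: red_def)
  moreover have "?r x \<le> ?r a \<longleftrightarrow> x \<le> a" if "x \<in> set w" for x
    using strict_mono_on_less_eq[OF m that, of a] Cons by simp
  ultimately show ?thesis using w by (auto simp: basic_iff)
qed (simp add: red_def)

lemma weight_red:
  assumes "multiplicative_fun \<omega>" "distinct w"
  shows "weight \<omega> (red w) = weight \<omega> w"
  using assms unfolding weight_def noninversions_red multiplicative_fun_def by metis

text \<open>Since \<open>red\<close> is a bijection that preserves weights, only the size of the
  content matters.\<close>

lemma sum_weight_permutations:
  assumes "multiplicative_fun \<omega>" "finite E"
  shows "(\<Sum>w\<in>permutations_of_set E. weight \<omega> w) = (\<Sum>w\<in>perms (card E). weight \<omega> w)"
proof -
  have "(\<Sum>w\<in>perms (card E). weight \<omega> w) = (\<Sum>w\<in>permutations_of_set E. weight \<omega> (red w))"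
    unfolding red_image[OF assms(2), symmetric] sum.reindex[OF inj_on_red[OF assms(2)]] by simp
  also have "\<dots> = (\<Sum>w\<in>permutations_of_set E. weight \<omega> w)"
    using assms by (intro sum.cong HOL.refl weight_red) (auto simp: permutations_of_set_def)
  finally show ?thesis ..
qed

lemma sum_weight_basic:
  assumes "multiplicative_fun \<omega>" "finite E"
  shows "(\<Sum>w | w \<in> permutations_of_set E \<and> basic w. weight \<omega> w) =
    (\<Sum>w\<in>basic_perms (card E). weight \<omega> w)"
proof -
  let ?B = "{w \<in> permutations_of_set E. basic w}"
  have "red ` ?B = basic_perms (card E)"
    unfolding basic_perms_def red_image[OF assms(2), symmetric]
    by (auto simp: permutations_of_set_def basic_red_iff)
  moreover have "inj_on red ?B"
    by (rule inj_on_subset[OF inj_on_red[OF assms(2)]]) auto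
  ultimately have "(\<Sum>w\<in>basic_perms (card E). weight \<omega> w) = (\<Sum>w\<in>?B. weight \<omega> (red w))"
    by (metis (no_types, lifting) sum.reindex_cong)
  also have "\<dots> = (\<Sum>w\<in>?B. weight \<omega> w)"
    using assms by (intro sum.cong HOL.refl weight_red) (auto simp: permutations_of_set_def)
  finally show ?thesis ..
qed

section \<open>Cutting a word before its greatest letter\<close>

lemma basic_Cons: "basic (m # v) \<longleftrightarrow> distinct (m # v) \<and> (\<forall>x\<in>set v. x < m)"
  by (auto simp: basic_iff order.strict_iff_order)

text \<open>The first letter is forced to be the greatest one, and the others may follow in any
  order. A sum over \<open>v\<close> thus becomes a sum over basic words.\<close>

lemma basic_permutations_insert_top:
  assumes "\<And>x. x \<in> E \<Longrightarrow> x < m"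
  shows "{w \<in> permutations_of_set (insert m E). basic w} = (#) m ` permutations_of_set E"
proof (intro subset_antisym subsetI)
  fix w assume w: "w \<in> {w \<in> permutations_of_set (insert m E). basic w}"
  then obtain a v where v: "w = a # v" by (cases w) (auto simp: basic_def)
  have *: "set w = insert m E" "distinct w" "\<forall>x\<in>set v. x < a"
    using w v by (auto simp: permutations_of_set_def basic_Cons)
  have "a = m" using * v assms
    by (metis insertE insertI1 list.set_intros(1) list.simps(15) not_less_iff_gr_or_eq)
  moreover have "m \<notin> E" using assms[of m] by auto
  ultimately have "set v = E" using * v insert_ident[of m "set v" E] by auto
  then show "w \<in> (#) m ` permutations_of_set E"
    using * v \<open>a = m\<close> by (auto simp: permutations_of_set_def)
next
  fix w assume "w \<in> (#) m ` permutations_of_set E"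
  then show "w \<in> {w \<in> permutations_of_set (insert m E). basic w}"
    using assms assms[of m] by (auto simp: permutations_of_set_def basic_Cons)
qed

text \<open>The letter \<open>m\<close> occurs exactly once in the word, so prefix and suffix can be
  read off from it, and \<open>E\<close> is the letter set of the prefix.\<close>

lemma bij_betw_cut_at_top:
  fixes m :: "'a::linorder"
  assumes "\<And>x. x \<in> A \<Longrightarrow> x < m"
  shows "bij_betw (\<lambda>(E, u, v). u @ m # v)
    (SIGMA E:Pow A. permutations_of_set E \<times> permutations_of_set (A - E))
    (permutations_of_set (insert m A))"
proof -
  have m: "m \<notin> A" using assms[of m] by auto
  show ?thesis
  proof (intro bij_betw_imageI inj_onI subset_antisym subsetI)
    fix p p' assume p: "p \<in> (SIGMA E:Pow A. permutations_of_set E \<times> permutations_of_set (A - E))"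
      "p' \<in> (SIGMA E:Pow A. permutations_of_set E \<times> permutations_of_set (A - E))"
      and eq: "(case p of (E, u, v) \<Rightarrow> u @ m # v) = (case p' of (E, u, v) \<Rightarrow> u @ m # v)"
    obtain E u v E' u' v' where [simp]: "p = (E, u, v)" "p' = (E', u', v')"
      by (cases p; cases p') auto
    have s: "set u = E" "set u' = E'" "E \<subseteq> A" "E' \<subseteq> A" "set v \<subseteq> A"  "set v' \<subseteq> A"
      using p by (auto simp: permutations_of_set_def)
    then have "u = u' \<and> v = v'"
      using eq m append_Cons_eq_iff[of m u v u' v'] by auto
    then show "p = p'" using s by simp
  next
    fix w assume "w \<in> permutations_of_set (insert m A)"
    then have w: "set w = insert m A" "distinct w" by (auto simp: permutations_of_set_def)
    then obtain u v where uv: "w = u @ m # v" by (metis insertI1 split_list)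
    then have "(set u, u, v) \<in> (SIGMA E:Pow A. permutations_of_set E \<times> permutations_of_set (A - E))"
      using w m by (auto simp: permutations_of_set_def)
    then show "w \<in> (\<lambda>(E, u, v). u @ m # v) `
        (SIGMA E:Pow A. permutations_of_set E \<times> permutations_of_set (A - E))"
      by (rule rev_image_eqI) (simp add: uv)
  next
    fix w assume "w \<in> (\<lambda>(E, u, v). u @ m # v) `
        (SIGMA E:Pow A. permutations_of_set E \<times> permutations_of_set (A - E))"
    then obtain E u v where "w = u @ m # v" "E \<subseteq> A" "u \<in> permutations_of_set E"
      "v \<in> permutations_of_set (A - E)" by auto
    then show "w \<in> permutations_of_set (insert m A)"
      using m by (auto simp: permutations_of_set_def)
  qed
qed

text \<open>The suffix \<open>m # v\<close> is basic and its head is above all of \<open>u\<close>,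
  so \<omega> splits. Across the cut, \<open>m\<close> forms a non-inversion with each letter of
  \<open>u\<close>, whence \<open>qq ^ card E\<close>; the remaining pairs are those between
  \<open>E\<close> and \<open>A - E\<close>.\<close>

lemma weight_cut:
  assumes "multiplicative_fun \<omega>" "u \<in> permutations_of_set E" "v \<in> permutations_of_set (A - E)"
    "E \<subseteq> A" "finite A" "\<And>x. x \<in> A \<Longrightarrow> x < m"
  shows "weight \<omega> (u @ m # v) =
    of_ratfun (qq ^ card E * qq ^ ascending_pairs E (A - E)) * (weight \<omega> u * weight \<omega> (m # v))"
proof -
  have uv: "set u = E" "set v = A - E" "distinct u" "distinct v"
    using assms by (auto simp: permutations_of_set_def)
  have d: "distinct (u @ m # v)" using uv assms(4) assms(6)[of m] by auto
  have b: "basic (m # v)" using uv d assms(6) by (auto simp: basic_Cons)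
  have "\<omega> (u @ m # v) = \<omega> u * \<omega> (m # v)"
    using uv assms(4,6) by (intro multiplicative_fun_append_basic[OF assms(1) d b]) auto
  moreover have "noninversions (u @ m # v) =
      ascending_pairs E (A - E) + card E + noninversions u + noninversions (m # v)"
  proof -
    have "ascending_pairs E (insert m (A - E)) = ascending_pairs E (A - E) + card E"
      using assms(4,5,6) finite_subset[OF assms(4,5)]
      by (intro ascending_pairs_insert_top_right) auto
    then show ?thesis using noninversions_append[OF d] uv by simp
  qed
  ultimately show ?thesis
    by (simp add: weight_def pure_tensor_mult power_add ac_simps)
qed

lemma sum_weight_Suc:
  fixes \<omega> :: "nat list \<Rightarrow> 'r::comm_rat_algebra"
  assumes "multiplicative_fun \<omega>"
  shows "(\<Sum>w\<in>perms (Suc n). weight \<omega> w) =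
    (\<Sum>k\<le>n. of_ratfun (qq ^ k * qsubsets n k) *
      ((\<Sum>w\<in>perms k. weight \<omega> w) * (\<Sum>w\<in>basic_perms (Suc n - k). weight \<omega> w)))"
proof -
  let ?A = "{1..n}"
  define G where "G k = (\<Sum>w\<in>perms k. weight \<omega> w)" for k
  define H where "H k = (\<Sum>w\<in>basic_perms k. weight \<omega> w)" for k
  let ?q = "\<lambda>E. of_ratfun (qq ^ card E * qq ^ ascending_pairs E (?A - E)) :: 'r qext"
  have A: "{1..Suc n} = insert (Suc n) ?A" by auto
  have fin: "finite E" if "E \<subseteq> ?A" for E using that finite_subset by blast
  \<comment> \<open>The words \<open>Suc n # v\<close> are all basic words on \<open>?A - E\<close>
    together with \<open>Suc n\<close>; this extra letter accounts for the size
    \<open>Suc n - card E\<close>.\<close>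
  have H: "(\<Sum>v\<in>permutations_of_set (?A - E). weight \<omega> (Suc n # v)) = H (Suc n - card E)"
    if E: "E \<subseteq> ?A" for E
  proof -
    have "card (insert (Suc n) (?A - E)) = Suc n - card E"
      using E fin[OF E] card_mono[OF _ E] by (simp add: card_Diff_subset Suc_diff_le)
    then have "H (Suc n - card E) = (\<Sum>w\<in>(#) (Suc n) ` permutations_of_set (?A - E). weight \<omega> w)"
      unfolding H_def using sum_weight_basic[OF assms, of "insert (Suc n) (?A - E)"]
      by (subst basic_permutations_insert_top[symmetric]) auto
    then show ?thesis by (simp add: sum.reindex)
  qed
  have "(\<Sum>w\<in>perms (Suc n). weight \<omega> w) =
      (\<Sum>(E, u, v)\<in>(SIGMA E:Pow ?A. permutations_of_set E \<times> permutations_of_set (?A - E)).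
        weight \<omega> (u @ Suc n # v))"
    unfolding perms_def A
    using sum.reindex_bij_betw[OF bij_betw_cut_at_top[of ?A "Suc n"], of "weight \<omega>"]
    by (simp add: case_prod_unfold)
  also have "\<dots> = (\<Sum>E\<in>Pow ?A. \<Sum>(u, v)\<in>permutations_of_set E \<times> permutations_of_set (?A - E).
      weight \<omega> (u @ Suc n # v))"
    by (subst sum.Sigma) (auto simp: case_prod_unfold)
  also have "\<dots> = (\<Sum>E\<in>Pow ?A. ?q E * (G (card E) * H (Suc n - card E)))"
  proof (rule sum.cong)
    fix E assume "E \<in> Pow ?A"
    then have E: "E \<subseteq> ?A" by simp
    have "(\<Sum>(u, v)\<in>permutations_of_set E \<times> permutations_of_set (?A - E). weight \<omega> (u @ Suc n # v)) =
      (\<Sum>(u, v)\<in>permutations_of_set E \<times> permutations_of_set (?A - E).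
        ?q E * (weight \<omega> u * weight \<omega> (Suc n # v)))"
      using E by (intro sum.cong HOL.refl) (auto intro!: weight_cut[OF assms])
    also have "\<dots> = ?q E * ((\<Sum>u\<in>permutations_of_set E. weight \<omega> u) *
        (\<Sum>v\<in>permutations_of_set (?A - E). weight \<omega> (Suc n # v)))"
      unfolding sum_product sum.cartesian_product
      by (simp add: sum_distrib_left case_prod_unfold)
    also have "\<dots> = ?q E * (G (card E) * H (Suc n - card E))"
      unfolding H[OF E] sum_weight_permutations[OF assms fin[OF E]] G_def ..
    finally show "(\<Sum>(u, v)\<in>permutations_of_set E \<times> permutations_of_set (?A - E).
      weight \<omega> (u @ Suc n # v)) = ?q E * (G (card E) * H (Suc n - card E))" .
  qed simp
  \<comment> \<open>Once \<open>card E = k\<close> is fixed, only the power counting ascending pairs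
    still varies with \<open>E\<close>, and its sum is \<open>qsubsets n k\<close>.\<close>
  also have "\<dots> = (\<Sum>k\<le>n. \<Sum>E | E \<in> Pow ?A \<and> card E = k. ?q E * (G (card E) * H (Suc n - card E)))"
    using card_mono[of ?A] by (intro sum.group[symmetric]) fastforce+
  also have "\<dots> = (\<Sum>k\<le>n. of_ratfun (qq ^ k * qsubsets n k) * (G k * H (Suc n - k)))"
    by (intro sum.cong HOL.refl)
      (simp add: qsubsets_def sum_distrib_left sum_distrib_right of_ratfun_sum)
  finally show ?thesis unfolding G_def H_def .
qed

section \<open>The \<open>q\<close>-differential equation\<close>

text \<open>Coefficient m of the equation expresses [m+1] times coefficient m+1 of the solution by
  coefficients up to m, and [m+1] is invertible.\<close>

lemma fps_eq_of_qderiv_eq: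
  fixes X Y D :: "'r::comm_rat_algebra qext fps"
  assumes "fps_nth X 0 = fps_nth Y 0" "qderiv X = qdilate X * D" "qderiv Y = qdilate Y * D"
  shows "X = Y"
proof (rule fps_ext)
  fix n show "fps_nth X n = fps_nth Y n"
  proof (induction n rule: less_induct)
    case (less n)
    show ?case
    proof (cases n)
      case (Suc m)
      have "fps_nth (qderiv X) m = fps_nth (qderiv Y) m"
        unfolding assms(2,3) fps_mult_nth qdilate_nth
        using less.IH Suc by (intro sum.cong) auto
      then show ?thesis
        unfolding qderiv_nth Suc by (rule of_ratfun_inverse_cancel[rotated]) (simp add: qint_neq_0)
    qed (use assms(1) in simp)
  qed
qed

lemma qstar_compose_nth:
  "fps_nth (qstar_compose G F) n = (\<Sum>k\<le>n. fps_nth G k * fps_nth (qstar_power F k) n)"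
proof -
  have "\<forall>\<^sub>F N in sequentially. fps_nth (\<Sum>k<N. fps_const (fps_nth G k) * qstar_power F k) n =
      fps_nth (qstar_compose G F) n"
    using qstar_compose_sums[of G F] unfolding sums_def tendsto_fps_iff by blast
  then obtain N where N: "\<And>M. M \<ge> N \<Longrightarrow>
      fps_nth (\<Sum>k<M. fps_const (fps_nth G k) * qstar_power F k) n = fps_nth (qstar_compose G F) n"
    by (auto simp: eventually_sequentially)
  \<comment> \<open>The bound is large enough both for the partial sums to have become stationary in
    degree n and for every k \<le> n to occur. The terms with k > n vanish, since
    \<open>qstar_power F k\<close> starts in degree k or later.\<close>
  have "fps_nth (qstar_compose G F) n =
      (\<Sum>k<max N (Suc n). fps_nth G k * fps_nth (qstar_power F k) n)"
    using N[of "max N (Suc n)"] by (simp add: fps_sum_nth)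
  also have "\<dots> = (\<Sum>k\<le>n. fps_nth G k * fps_nth (qstar_power F k) n)"
    by (intro sum.mono_neutral_right) (auto simp: qstar_power_nth_eq_0)
  finally show ?thesis .
qed

text \<open>The binomial exponent grows by k from k to k+1 and the factorial by [k+1]. The scalar in
  the definition of the star powers cancels exactly this, which makes \<open>qExp\<close> the
  exponential for this composition.\<close>

lemma qExp_Suc:
  "fps_nth qExp (Suc k) * of_ratfun (qint (Suc k) * inverse (qq ^ k)) =
    (fps_nth qExp k :: 'r::comm_rat_algebra qext)"
proof -
  have q0: "qq \<noteq> 0"
    using qq_power_neq_1[of 1] by (auto simp: qq_def Zero_fract_def eq_fract)
  have "qq ^ (Suc k choose 2) / qfact (Suc k) * (qint (Suc k) * inverse (qq ^ k)) =
      qq ^ (k choose 2) / qfact k"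
    using q0 qint_neq_0[of "Suc k"] qfact_neq_0[of k]
    by (simp add: qfact_Suc numeral_2_eq_2 power_add field_simps)
  then show ?thesis by (simp add: qExp_def pure_tensor_mult)
qed

lemma qderiv_qstar_compose_qExp:
  fixes F :: "'r::comm_rat_algebra qext fps"
  shows "qderiv (qstar_compose qExp F) = qdilate (qstar_compose qExp F) * qderiv F"
proof (rule fps_ext)
  fix n
  let ?P = "qstar_power F" and ?e = "fps_nth qExp :: nat \<Rightarrow> 'r qext"
  have "fps_nth (qderiv (qstar_compose qExp F)) n = (\<Sum>k\<le>Suc n. ?e k * fps_nth (qderiv (?P k)) n)"
    by (simp only: qderiv_nth qstar_compose_nth sum_distrib_left mult.left_commute)
  \<comment> \<open>The star power of index 0 is the constant 1 and has derivative 0, so the index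
    can be shifted.\<close>
  also have "\<dots> = (\<Sum>k\<le>n. ?e (Suc k) * fps_nth (qderiv (?P (Suc k))) n)"
    by (subst sum.atMost_Suc_shift) (simp add: qderiv_nth del: qstar_power.simps(2))
  also have "\<dots> = (\<Sum>k\<le>n. ?e k * fps_nth (qdilate (?P k) * qderiv F) n)"
    unfolding qstar_power_Suc(2) mult.assoc fps_mult_left_const_nth
    unfolding mult.assoc[symmetric] qExp_Suc ..
  also have "\<dots> = (\<Sum>k\<le>n. \<Sum>i\<le>n. of_ratfun (qq ^ i) * (?e k * fps_nth (?P k) i) *
      fps_nth (qderiv F) (n - i))"
    unfolding fps_mult_nth qdilate_nth sum_distrib_left atLeast0AtMost by (simp only: ac_simps)
  also have "\<dots> = (\<Sum>i\<le>n. \<Sum>k\<le>n. of_ratfun (qq ^ i) * (?e k * fps_nth (?P k) i) *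
      fps_nth (qderiv F) (n - i))"
    by (rule sum.swap)
  \<comment> \<open>Star powers of index k > i have no coefficient in degree i; the inner sum is now
    the one in \<open>qstar_compose_nth\<close>.\<close>
  also have "\<dots> = (\<Sum>i\<le>n. \<Sum>k\<le>i. of_ratfun (qq ^ i) * (?e k * fps_nth (?P k) i) *
      fps_nth (qderiv F) (n - i))"
    by (intro sum.cong HOL.refl sum.mono_neutral_right) (auto simp: qstar_power_nth_eq_0)
  also have "\<dots> = fps_nth (qdilate (qstar_compose qExp F) * qderiv F) n"
    by (simp add: fps_mult_nth qdilate_nth qstar_compose_nth sum_distrib_left sum_distrib_right
        atLeast0AtMost)
  finally show "fps_nth (qderiv (qstar_compose qExp F)) n =
      fps_nth (qdilate (qstar_compose qExp F) * qderiv F) n" .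
qed

theorem theorem6p7:
  fixes \<omega> :: "nat list \<Rightarrow> 'r::comm_rat_algebra"
    and \<gamma> f :: "nat \<Rightarrow> 'r qext"
    and F :: "'r qext fps"
  assumes "multiplicative_fun \<omega>"
    and "\<And>n. \<gamma> n = (\<Sum>\<pi>\<in>perms n. \<omega> \<pi> \<otimes>\<^sub>Q qq ^ noninversions \<pi>)"
    and "\<And>n. n \<ge> 1 \<Longrightarrow> f n = (\<Sum>\<beta>\<in>basic_perms n. \<omega> \<beta> \<otimes>\<^sub>Q qq ^ noninversions \<beta>)"
    and "F = Abs_fps (\<lambda>n. if n = 0 then 0 else f n * of_ratfun (1 / qfact n))"
  shows "Abs_fps (\<lambda>n. \<gamma> n * of_ratfun (1 / qfact n)) = qstar_compose qExp F"
proof (rule fps_eq_of_qderiv_eq[OF _ _ qderiv_qstar_compose_qExp])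
  let ?G = "Abs_fps (\<lambda>n. \<gamma> n * of_ratfun (1 / qfact n))"
  have "\<gamma> 0 = 1"
    using multiplicative_fun_Nil[OF assms(1)]
    by (simp add: assms(2) perms_def noninversions_def pure_tensor_one)
  then show "fps_nth ?G 0 = fps_nth (qstar_compose qExp F) 0"
    by (simp add: qstar_compose_nth qExp_def numeral_2_eq_2 pure_tensor_one)
  \<comment> \<open>The q-derivative replaces [n+1]! by [n]! in a series with q-factorial
    denominators.\<close>
  have qf: "of_ratfun (qint (Suc n)) * (x * of_ratfun (1 / qfact (Suc n))) =
      x * of_ratfun (1 / qfact n)" for n and x :: "'r qext"
  proof -
    have "qint (Suc n) * (1 / qfact (Suc n)) = 1 / qfact n"
      using qint_neq_0[of "Suc n"] by (simp add: qfact_Suc)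
    then show ?thesis by (metis mult.left_commute of_ratfun_mult)
  qed
  show "qderiv ?G = qdilate ?G * qderiv F"
  proof (rule fps_ext)
    fix n
    have "fps_nth (qderiv ?G) n = \<gamma> (Suc n) * of_ratfun (1 / qfact n)"
      by (simp only: qderiv_nth fps_nth_Abs_fps qf)
    \<comment> \<open>For k \<le> n the index \<open>Suc n - k\<close> is at least 1, so the sum
      formula for \<open>f\<close> applies.\<close>
    also have "\<gamma> (Suc n) = (\<Sum>k\<le>n. of_ratfun (qq ^ k * qsubsets n k) * (\<gamma> k * f (Suc n - k)))"
      using sum_weight_Suc[OF assms(1), of n] by (simp add: weight_def assms(2,3))
    also have "\<dots> * of_ratfun (1 / qfact n) =
        (\<Sum>k\<le>n. of_ratfun (qq ^ k) * (\<gamma> k * of_ratfun (1 / qfact k)) *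
          (f (Suc (n - k)) * of_ratfun (1 / qfact (n - k))))"
      unfolding sum_distrib_right
    proof (rule sum.cong)
      fix k assume "k \<in> {..n}"
      then have k: "k \<le> n" by simp
      \<comment> \<open>Division by [n]! splits the q-binomial coefficient into the denominators of
        the two series in the Cauchy product; the power \<open>qq ^ k\<close> is left over for the
        dilation.\<close>
      have "qsubsets n k * (1 / qfact n) = 1 / qfact k * (1 / qfact (n - k))"
        using qsubsets_qfact[OF k] qfact_neq_0[of n] qfact_neq_0[of k] qfact_neq_0[of "n - k"]
        by (simp add: field_simps)
      then have "of_ratfun (qsubsets n k) * of_ratfun (1 / qfact n) =
          (of_ratfun (1 / qfact k) * of_ratfun (1 / qfact (n - k)) :: 'r qext)"
        by (metis of_ratfun_mult)
      then have "of_ratfun (qq ^ k) * (\<gamma> k * f (Suc n - k)) *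
            (of_ratfun (qsubsets n k) * of_ratfun (1 / qfact n)) =
          of_ratfun (qq ^ k) * (\<gamma> k * f (Suc n - k)) *
            (of_ratfun (1 / qfact k) * of_ratfun (1 / qfact (n - k)))"
        by (rule arg_cong)
      then show "of_ratfun (qq ^ k * qsubsets n k) * (\<gamma> k * f (Suc n - k)) * of_ratfun (1 / qfact n) =
          of_ratfun (qq ^ k) * (\<gamma> k * of_ratfun (1 / qfact k)) *
          (f (Suc (n - k)) * of_ratfun (1 / qfact (n - k)))"
        unfolding of_ratfun_mult Suc_diff_le[OF k] by (simp only: ac_simps)
    qed simp
    also have "\<dots> = fps_nth (qdilate ?G * qderiv F) n"
      by (simp add: fps_mult_nth qdilate_nth qderiv_nth assms(4) qf atLeast0AtMost
          del: One_nat_def)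
    finally show "fps_nth (qderiv ?G) n = fps_nth (qdilate ?G * qderiv F) n" .
  qed
qed

end
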